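(* Let $n\ge 1$. Assign algebraically independent weights to the edges of the directed graph $G_n$. For each dot $D$ in the triangular array $T_{n,3}$ and each $1\le i\le n$, let $v_{D,i}$ be the sum of the weights of all directed paths in $G_n$ from dot $D$ to dot $i$ on the bottom row. Then the path vectors $v_D=(v_{D,1},\dots,v_{D,n})$, $D\in T_{n,3}$, are a geometric representation of the matroid $\mathcal{T}_{n,3}$; that is, a set of dots is independent in $\mathcal{T}_{n,3}$ if and only if the corresponding (indexed) family of path vectors is linearly independent.
   Context: $T_{n,3}=\{x\in\mathbb{Z}_{\ge0}^3: x_1+x_2+x_3=n-1\}$, viewed as a triangular array of dots with $n$ dots on each side; the rows are the sets of constant $x_1$, with top dot $(n-1,0,0)$ and bottom row $\{x_1=0\}$. $G_n$ is the directed graph with vertex set $T_{n,3}$ in which each dot not on the bottom row is joined by a directed edge to each of the two dots directly below it: $x\to x-e_1+e_2$ and $x\to x-e_1+e_3$ ($e_i$ standard basis vectors). The dots on the bottom row are labelled $1,2,\dots,n$ in order from left to right. Edge weights are complex numbers algebraically independent over $\mathbb{Q}$. The weight of a path is the product of the weights of its edges (the empty path has weight $1$). $\mathcal{T}_{n,3}$ is the matroid on $T_{n,3}$ whose independent sets are the subsets $I$ such that, for every $1\le k\le n$ and all $a\in\mathbb{Z}_{\ge0}^3$ with $a_1+a_2+a_3=n-k$, the set $\{x\in T_{n,3}:x_i\ge a_i\ \forall i\}$ contains at most $k$ points of $I$. *)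

theory Defs
  imports
    Complex_Main
    "HOL-Library.Poly_Mapping"
    "Graph_Theory.Graph_Theory"
    "Jordan_Normal_Form.VS_Connect"
begin

type_synonym dot = "nat \<times> nat \<times> nat"

text \<open>Because of truncated subtraction, \<open>tri 0 = tri 1\<close>; only \<open>n \<ge> 1\<close> is meant.\<close>

definition tri :: "nat \<Rightarrow> dot set" where
  "tri n = {(x1, x2, x3). x1 + x2 + x3 = n - 1}"

definition tri_edges :: "nat \<Rightarrow> (dot \<times> dot) set" where
  "tri_edges n =
     {((Suc x1, x2, x3), (x1, Suc x2, x3)) | x1 x2 x3. (Suc x1, x2, x3) \<in> tri n} \<union>
     {((Suc x1, x2, x3), (x1, x2, Suc x3)) | x1 x2 x3. (Suc x1, x2, x3) \<in> tri n}"

definition tri_graph :: "nat \<Rightarrow> dot pair_pre_digraph" where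
  "tri_graph n = \<lparr> pverts = tri n, parcs = tri_edges n \<rparr>"

text \<open>
  The left-hand neighbour below a dot is the one with larger second coordinate, so the
  bottom row reads \<open>(0, n-1, 0), (0, n-2, 1), \<dots>, (0, 0, n-1)\<close> from left to right;
  \<open>bottom_dot n i\<close> is meant for \<open>1 \<le> i \<le> n\<close>.
\<close>

definition bottom_dot :: "nat \<Rightarrow> nat \<Rightarrow> dot" where
  "bottom_dot n i = (0, n - i, i - 1)"

definition tri_indep :: "nat \<Rightarrow> dot set \<Rightarrow> bool" where
  "tri_indep n I \<longleftrightarrow> I \<subseteq> tri n \<and>
     (\<forall>k a1 a2 a3. 1 \<le> k \<and> k \<le> n \<and> a1 + a2 + a3 = n - k \<longrightarrow>
        card (I \<inter> {(x1, x2, x3) \<in> tri n. a1 \<le> x1 \<and> a2 \<le> x2 \<and> a3 \<le> x3}) \<le> k)"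

text \<open>
  A polynomial with rational coefficients in variables of type \<open>'v\<close> is a finitely supported
  function from monomials (finitely supported exponent functions) to coefficients.
\<close>

definition poly_eval :: "('v \<Rightarrow> complex) \<Rightarrow> (('v \<Rightarrow>\<^sub>0 nat) \<Rightarrow>\<^sub>0 rat) \<Rightarrow> complex" where
  "poly_eval w p =
     (\<Sum>m \<in> Poly_Mapping.keys p. of_rat (Poly_Mapping.lookup p m) *
        (\<Prod>e \<in> Poly_Mapping.keys m. w e ^ Poly_Mapping.lookup m e))"

text \<open>Algebraic independence over the rationals of the family \<open>w\<close> indexed by \<open>E\<close>.\<close>

definition alg_independent_on :: "'v set \<Rightarrow> ('v \<Rightarrow> complex) \<Rightarrow> bool" where
  "alg_independent_on E w \<longleftrightarrow>
     (\<forall>p :: ('v \<Rightarrow>\<^sub>0 nat) \<Rightarrow>\<^sub>0 rat.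
        (\<forall>m \<in> Poly_Mapping.keys p. Poly_Mapping.keys m \<subseteq> E) \<and> poly_eval w p = 0 \<longrightarrow> p = 0)"

definition path_weight :: "(dot \<times> dot \<Rightarrow> complex) \<Rightarrow> (dot \<times> dot) awalk \<Rightarrow> complex" where
  "path_weight w p = prod_list (map w p)"

definition path_sum :: "nat \<Rightarrow> (dot \<times> dot \<Rightarrow> complex) \<Rightarrow> dot \<Rightarrow> nat \<Rightarrow> complex" where
  "path_sum n w D i =
     (\<Sum>p \<in> {p. pre_digraph.apath (with_proj (tri_graph n)) D p (bottom_dot n i)}.
        path_weight w p)"

text \<open>Vector indices start at 0 here, labels of bottom dots at 1.\<close>

definition path_vector :: "nat \<Rightarrow> (dot \<times> dot \<Rightarrow> complex) \<Rightarrow> dot \<Rightarrow> complex vec" where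
  "path_vector n w D = vec n (\<lambda>j. path_sum n w D (j + 1))"

text \<open>
  Linear independence in \<open>\<complex>\<^sup>n\<close> of the family \<open>v\<close> indexed by \<open>I\<close>; injectivity is needed since
  \<open>lin_dep\<close> is about sets of vectors and ignores repetitions.
\<close>

definition lin_indep_family :: "nat \<Rightarrow> ('i \<Rightarrow> complex vec) \<Rightarrow> 'i set \<Rightarrow> bool" where
  "lin_indep_family n v I \<longleftrightarrow>
     inj_on v I \<and>
     \<not> LinearCombinations.module.lin_dep class_ring (module_vec TYPE(complex) n) (v ` I)"

lemma finite_tri: "finite (tri n)"
  by (rule finite_subset[of _ "{..n} \<times> {..n} \<times> {..n}"]) (auto simp: tri_def)

lemma pair_fin_digraph_tri_graph: "pair_fin_digraph (tri_graph n)"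
proof
  show "finite (pverts (tri_graph n))"
    by (simp add: tri_graph_def finite_tri)
  have "tri_edges n \<subseteq> tri n \<times> tri n"
    by (auto simp: tri_edges_def tri_def)
  then show "finite (parcs (tri_graph n))"
    by (simp add: tri_graph_def) (meson finite_SigmaI finite_subset finite_tri)
qed (auto simp: tri_graph_def tri_edges_def tri_def)

text \<open>The sum defining \<open>path_sum\<close> is therefore finite.\<close>

lemma finite_paths: "finite {p. pre_digraph.apath (with_proj (tri_graph n)) D p D'}"
proof -
  interpret pair_fin_digraph "tri_graph n"
    by (rule pair_fin_digraph_tri_graph)
  show ?thesis
    by (rule apaths_finite)
qed

end

theory Submission
  imports Defs
begin

text \<open>
  The path vectors of the dots in a subtriangle of side \<open>k\<close> lie in the span of the \<open>k\<close> path vectors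
  of its bottom row, so linearly independent families are independent in the matroid.
  Conversely, a point of an independent set can always be replaced by one of the two dots below
  it. Repeating this for a highest point routes the set to the bottom row along disjoint paths;
  giving the edges of these paths weight \<open>1\<close>, and the other edges leaving them weight \<open>0\<close>, turns
  the path vectors into distinct unit vectors. Hence some minor of the matrix of path vectors is a
  nonzero polynomial in the weights, and it does not vanish at algebraically independent ones.
\<close>

section \<open>Polynomial functions over the rationals\<close>

definition monom_eval :: "('v \<Rightarrow> complex) \<Rightarrow> ('v \<Rightarrow>\<^sub>0 nat) \<Rightarrow> complex" where
  "monom_eval w m = (\<Prod>e \<in> Poly_Mapping.keys m. w e ^ Poly_Mapping.lookup m e)"

text \<open>Exponents outside the support are 0 and contribute factors 1, so two monomials can be
  evaluated over a common index set.\<close>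

lemma monom_eval_superset:
  assumes "finite S" "Poly_Mapping.keys m \<subseteq> S"
  shows "monom_eval w m = (\<Prod>e \<in> S. w e ^ Poly_Mapping.lookup m e)"
  unfolding monom_eval_def
  by (rule prod.mono_neutral_left) (use assms in \<open>auto simp: in_keys_iff\<close>)

lemma monom_eval_add: "monom_eval w (m + m') = monom_eval w m * monom_eval w m'"
proof -
  define S where "S = Poly_Mapping.keys m \<union> Poly_Mapping.keys m'"
  have "finite S" "Poly_Mapping.keys m \<subseteq> S" "Poly_Mapping.keys m' \<subseteq> S"
    "Poly_Mapping.keys (m + m') \<subseteq> S"
    using Poly_Mapping.keys_add[of m m'] by (auto simp: S_def)
  then show ?thesis
    by (simp add: monom_eval_superset[of S] lookup_add power_add prod.distrib)
qed

lemma poly_eval_superset: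
  assumes "finite S" "Poly_Mapping.keys p \<subseteq> S"
  shows "poly_eval w p = (\<Sum>m \<in> S. of_rat (Poly_Mapping.lookup p m) * monom_eval w m)"
  unfolding poly_eval_def monom_eval_def
  by (rule sum.mono_neutral_left) (use assms in \<open>auto simp: in_keys_iff\<close>)

lemma poly_eval_zero: "poly_eval w 0 = 0"
  by (simp add: poly_eval_def)

lemma poly_eval_single:
  "poly_eval w (Poly_Mapping.single m c) = of_rat c * monom_eval w m"
  by (subst poly_eval_superset[of "{m}"]) auto

lemma poly_eval_add: "poly_eval w (p + q) = poly_eval w p + poly_eval w q"
proof -
  define S where "S = Poly_Mapping.keys p \<union> Poly_Mapping.keys q"
  have "finite S" "Poly_Mapping.keys p \<subseteq> S" "Poly_Mapping.keys q \<subseteq> S"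
    "Poly_Mapping.keys (p + q) \<subseteq> S"
    using Poly_Mapping.keys_add[of p q] by (auto simp: S_def)
  then show ?thesis
    by (simp add: poly_eval_superset[of S] lookup_add of_rat_add distrib_right sum.distrib)
qed

lemma poly_eval_sum: "poly_eval w (\<Sum>a\<in>A. f a) = (\<Sum>a\<in>A. poly_eval w (f a))"
  by (induction A rule: infinite_finite_induct) (auto simp: poly_eval_zero poly_eval_add)

lemma sum_single_lookup:
  fixes p :: "'a \<Rightarrow>\<^sub>0 'b::comm_monoid_add"
  shows "p = (\<Sum>m\<in>Poly_Mapping.keys p. Poly_Mapping.single m (Poly_Mapping.lookup p m))"
  by (rule poly_mapping_eqI)
    (auto simp: lookup_sum lookup_single when_def in_keys_iff)

text \<open>Expanding both factors into single terms reduces the claim to multiplicativity on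
  monomials.\<close>

lemma poly_eval_mult:
  fixes p q :: "('v \<Rightarrow>\<^sub>0 nat) \<Rightarrow>\<^sub>0 rat"
  shows "poly_eval w (p * q) = poly_eval w p * poly_eval w q"
proof -
  have "p * q = (\<Sum>m\<in>Poly_Mapping.keys p. \<Sum>m'\<in>Poly_Mapping.keys q.
      Poly_Mapping.single (m + m') (Poly_Mapping.lookup p m * Poly_Mapping.lookup q m'))"
    by (subst sum_single_lookup[of p], subst sum_single_lookup[of q])
      (simp add: sum_product mult_single)
  then show ?thesis
    by (simp add: poly_eval_sum poly_eval_single monom_eval_add of_rat_mult)
      (simp add: poly_eval_def monom_eval_def[symmetric] sum_product mult_ac)
qed

text \<open>One polynomial must serve all \<open>w\<close> at once. Closure rules for such functions
  make it unnecessary to construct path sums and determinants as formal polynomials.\<close>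

definition poly_fun :: "'v set \<Rightarrow> (('v \<Rightarrow> complex) \<Rightarrow> complex) \<Rightarrow> bool" where
  "poly_fun E f \<longleftrightarrow> (\<exists>p. (\<forall>m \<in> Poly_Mapping.keys p. Poly_Mapping.keys m \<subseteq> E) \<and>
     (\<forall>w. poly_eval w p = f w))"

lemma poly_fun_of_rat: "poly_fun E (\<lambda>w. of_rat c)"
  unfolding poly_fun_def
  by (rule exI[of _ "Poly_Mapping.single 0 c"]) (auto simp: poly_eval_single monom_eval_def)

lemma poly_fun_0: "poly_fun E (\<lambda>w. 0)"
  using poly_fun_of_rat[of E 0] by simp

lemma poly_fun_1: "poly_fun E (\<lambda>w. 1)"
  using poly_fun_of_rat[of E 1] by simp

lemma poly_fun_var:
  assumes "e \<in> E"
  shows "poly_fun E (\<lambda>w. w e)"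
  unfolding poly_fun_def
  by (rule exI[of _ "Poly_Mapping.single (Poly_Mapping.single e 1) 1"])
    (use assms in \<open>auto simp: poly_eval_single monom_eval_def\<close>)

lemma poly_fun_add:
  assumes "poly_fun E f" "poly_fun E g"
  shows "poly_fun E (\<lambda>w. f w + g w)"
proof -
  from assms obtain p q where
    "\<forall>m \<in> Poly_Mapping.keys p. Poly_Mapping.keys m \<subseteq> E" "\<forall>w. poly_eval w p = f w"
    "\<forall>m \<in> Poly_Mapping.keys q. Poly_Mapping.keys m \<subseteq> E" "\<forall>w. poly_eval w q = g w"
    unfolding poly_fun_def by blast
  then show ?thesis
    unfolding poly_fun_def using Poly_Mapping.keys_add[of p q]
    by (intro exI[of _ "p + q"]) (simp add: poly_eval_add, blast)
qed

lemma poly_fun_mult: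
  assumes "poly_fun E f" "poly_fun E g"
  shows "poly_fun E (\<lambda>w. f w * g w)"
proof -
  from assms obtain p q where p:
    "\<forall>m \<in> Poly_Mapping.keys p. Poly_Mapping.keys m \<subseteq> E" "\<forall>w. poly_eval w p = f w"
    "\<forall>m \<in> Poly_Mapping.keys q. Poly_Mapping.keys m \<subseteq> E" "\<forall>w. poly_eval w q = g w"
    unfolding poly_fun_def by blast
  have "Poly_Mapping.keys m \<subseteq> E" if "m \<in> Poly_Mapping.keys (p * q)" for m
  proof -
    from that obtain a b where "m = a + b" "a \<in> Poly_Mapping.keys p" "b \<in> Poly_Mapping.keys q"
      using keys_mult[of p q] by blast
    then show ?thesis
      using p Poly_Mapping.keys_add[of a b] by blast
  qed
  with p show ?thesis
    unfolding poly_fun_def by (intro exI[of _ "p * q"]) (auto simp: poly_eval_mult)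
qed

lemma poly_fun_sum:
  assumes "\<And>a. a \<in> A \<Longrightarrow> poly_fun E (f a)"
  shows "poly_fun E (\<lambda>w. \<Sum>a\<in>A. f a w)"
  using assms
  by (induction A rule: infinite_finite_induct) (auto intro: poly_fun_0 poly_fun_add)

lemma poly_fun_prod:
  assumes "\<And>a. a \<in> A \<Longrightarrow> poly_fun E (f a)"
  shows "poly_fun E (\<lambda>w. \<Prod>a\<in>A. f a w)"
  using assms
  by (induction A rule: infinite_finite_induct) (auto intro: poly_fun_1 poly_fun_mult)

text \<open>A representing polynomial cannot be zero because of its value at \<open>w0\<close>. One
  well-chosen weighting thus settles the matter for every algebraically independent one.\<close>

lemma alg_independent_poly_fun_nonzero:
  assumes "alg_independent_on E w" "poly_fun E f" "f w0 \<noteq> 0"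
  shows "f w \<noteq> 0"
proof
  assume "f w = 0"
  from assms(2) obtain p where "\<forall>m \<in> Poly_Mapping.keys p. Poly_Mapping.keys m \<subseteq> E"
    and p: "\<forall>w. poly_eval w p = f w"
    unfolding poly_fun_def by blast
  with \<open>f w = 0\<close> assms(1) have "p = 0"
    unfolding alg_independent_on_def by metis
  with p have "f w0 = 0"
    by (metis poly_eval_zero)
  with assms(3) show False by simp
qed

text \<open>By the Leibniz formula, since signs of permutations are rational constants.\<close>

lemma poly_fun_det:
  assumes "\<And>i j. i < m \<Longrightarrow> j < m \<Longrightarrow> poly_fun E (\<lambda>w. a w i j)"
  shows "poly_fun E (\<lambda>w. det (mat m m (\<lambda>(i, j). a w i j)))"
proof -
  have *: "poly_fun E (\<lambda>w. signof p)" for p :: "nat \<Rightarrow> nat"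
    using poly_fun_of_rat[of E "signof p"] by (simp add: sign_def)
  have "det (mat m m (\<lambda>(i, j). a w i j)) =
      (\<Sum>p | p permutes {0..<m}. signof p * (\<Prod>i = 0..<m. a w i (p i)))" for w
    unfolding det_def by (auto intro!: sum.cong prod.cong simp: permutes_in_image)
  then show ?thesis
    by (simp only:) (intro poly_fun_sum poly_fun_mult poly_fun_prod *,
      auto intro!: assms simp: permutes_in_image)
qed

section \<open>Recursion for path sums\<close>

lemma tri_graph_simps: "pverts (tri_graph n) = tri n" "parcs (tri_graph n) = tri_edges n"
  by (simp_all add: tri_graph_def)

lemma apath_tri_graph_bottom:
  "pre_digraph.apath (with_proj (tri_graph n)) (0, x2, x3) p y \<longleftrightarrow>
     p = [] \<and> y = (0, x2, x3) \<and> y \<in> tri n"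
proof -
  interpret pair_fin_digraph "tri_graph n"
    by (rule pair_fin_digraph_tri_graph)
  show ?thesis
    by (cases p) (auto simp: apath_simps tri_graph_simps, auto simp: tri_edges_def)
qed

text \<open>Every edge lowers the first coordinate. Hence prepending an edge from a higher row never
  creates a repeated vertex.\<close>

lemma fst_awalk_verts_tri_graph:
  "pre_digraph.awalk (with_proj (tri_graph n)) u p v \<Longrightarrow>
     z \<in> set (pre_digraph.awalk_verts (with_proj (tri_graph n)) u p) \<Longrightarrow> fst z \<le> fst u"
proof (induction p arbitrary: u)
  interpret pair_fin_digraph "tri_graph n"
    by (rule pair_fin_digraph_tri_graph)
  {
    case Nil
    then show ?case by simp
  next
    case (Cons e p)
    then have e: "e \<in> tri_edges n" "u = fst e" and walk: "awalk (snd e) p v"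
      by (auto simp: awalk_Cons_iff tri_graph_simps)
    then have "fst (snd e) \<le> fst u"
      by (auto simp: tri_edges_def)
    then show ?case
      using Cons.IH[OF walk] Cons.prems(2) e by fastforce
  }
qed

text \<open>As \<open>y\<close> is on the bottom row, a path to it from a higher dot is nonempty,
  and its first edge leads to one of the two dots below.\<close>

lemma apath_tri_graph_Suc:
  assumes "(Suc x1, x2, x3) \<in> tri n" "fst y = 0"
  shows "{p. pre_digraph.apath (with_proj (tri_graph n)) (Suc x1, x2, x3) p y} =
    (\<lambda>p. ((Suc x1, x2, x3), (x1, Suc x2, x3)) # p) `
      {p. pre_digraph.apath (with_proj (tri_graph n)) (x1, Suc x2, x3) p y} \<union>
    (\<lambda>p. ((Suc x1, x2, x3), (x1, x2, Suc x3)) # p) `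
      {p. pre_digraph.apath (with_proj (tri_graph n)) (x1, x2, Suc x3) p y}"
    (is "?L = ?R")
proof -
  interpret pair_fin_digraph "tri_graph n"
    by (rule pair_fin_digraph_tri_graph)
  have notin: "(Suc x1, x2, x3) \<notin> set (awalk_verts (x1, z) p)" if "apath (x1, z) p y" for z p
    using fst_awalk_verts_tri_graph[of n "(x1, z)" p y "(Suc x1, x2, x3)"] that
    by (auto simp: apath_def)
  have edges: "((Suc x1, x2, x3), (x1, Suc x2, x3)) \<in> tri_edges n"
    "((Suc x1, x2, x3), (x1, x2, Suc x3)) \<in> tri_edges n"
    using assms(1) by (auto simp: tri_edges_def)
  have "p \<in> ?L \<longleftrightarrow> p \<in> ?R" for p
  proof (cases p)
    case Nil
    then show ?thesis using assms(2) by (auto simp: apath_Nil_iff)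
  next
    case (Cons e q)
    have "p \<in> ?L \<longleftrightarrow> (e = ((Suc x1, x2, x3), (x1, Suc x2, x3)) \<or>
        e = ((Suc x1, x2, x3), (x1, x2, Suc x3))) \<and> apath (snd e) q y"
      using edges notin Cons
      by (auto simp: apath_Cons_iff tri_graph_simps) (auto simp: tri_edges_def)
    also have "\<dots> \<longleftrightarrow> p \<in> ?R"
      using Cons by auto
    finally show ?thesis .
  qed
  then show ?thesis by blast
qed

lemma path_sum_Suc:
  assumes "(Suc x1, x2, x3) \<in> tri n"
  shows "path_sum n w (Suc x1, x2, x3) i =
    w ((Suc x1, x2, x3), (x1, Suc x2, x3)) * path_sum n w (x1, Suc x2, x3) i +
    w ((Suc x1, x2, x3), (x1, x2, Suc x3)) * path_sum n w (x1, x2, Suc x3) i"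
proof -
  have fst: "fst (bottom_dot n i) = 0" by (simp add: bottom_dot_def)
  show ?thesis
    unfolding path_sum_def apath_tri_graph_Suc[OF assms fst]
    by (subst sum.union_disjoint)
      (auto simp: finite_paths sum.reindex inj_on_def path_weight_def sum_distrib_left)
qed

lemma path_sum_bottom:
  assumes "(0, x2, x3) \<in> tri n" "1 \<le> i" "i \<le> n"
  shows "path_sum n w (0, x2, x3) i = (if i = Suc x3 then 1 else 0)"
proof -
  \<comment> \<open>The bounds on \<open>i\<close> keep both truncated subtractions in
    \<open>bottom_dot\<close> exact.\<close>
  have "(bottom_dot n i = (0, x2, x3)) \<longleftrightarrow> i = Suc x3"
    using assms by (auto simp: bottom_dot_def tri_def)
  then have "{p. pre_digraph.apath (with_proj (tri_graph n)) (0, x2, x3) p (bottom_dot n i)} =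
      (if i = Suc x3 then {[]} else {})"
    using assms by (auto simp: apath_tri_graph_bottom)
  then show ?thesis
    by (simp add: path_sum_def path_weight_def)
qed

lemma tri_below:
  assumes "(Suc x1, x2, x3) \<in> tri n"
  shows "(x1, Suc x2, x3) \<in> tri n" "(x1, x2, Suc x3) \<in> tri n"
  using assms by (auto simp: tri_def)

lemma poly_fun_path_sum:
  assumes "(x1, x2, x3) \<in> tri n" "1 \<le> i" "i \<le> n"
  shows "poly_fun (tri_edges n) (\<lambda>w. path_sum n w (x1, x2, x3) i)"
  using assms
proof (induction x1 arbitrary: x2 x3)
  case 0
  then show ?case
    by (cases "i = Suc x3") (simp_all add: path_sum_bottom poly_fun_0 poly_fun_1)
next
  case (Suc x1)
  have "((Suc x1, x2, x3), (x1, Suc x2, x3)) \<in> tri_edges n"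
    "((Suc x1, x2, x3), (x1, x2, Suc x3)) \<in> tri_edges n"
    using Suc.prems by (auto simp: tri_edges_def)
  then show ?case
    unfolding path_sum_Suc[OF Suc.prems(1)]
    by (intro poly_fun_add poly_fun_mult poly_fun_var Suc.IH tri_below[OF Suc.prems(1)] Suc.prems)
qed


text \<open>Paths from a dot use only edges leaving it or leaving lower rows. So the edges leaving
  one dot can be reweighted without affecting other dots in its row or below.\<close>

lemma path_sum_cong_below:
  assumes "(x1, x2, x3) \<in> tri n" "1 \<le> i" "i \<le> n"
    and "\<And>u v. u = (x1, x2, x3) \<or> fst u < x1 \<Longrightarrow> w (u, v) = w' (u, v)"
  shows "path_sum n w (x1, x2, x3) i = path_sum n w' (x1, x2, x3) i"
  using assms
proof (induction x1 arbitrary: x2 x3)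
  case 0
  then show ?case by (simp add: path_sum_bottom)
next
  case (Suc x1)
  have "path_sum n w (x1, y2, y3) i = path_sum n w' (x1, y2, y3) i"
    if "(x1, y2, y3) \<in> tri n" for y2 y3
    by (rule Suc.IH[OF that Suc.prems(2,3)]) (auto intro!: Suc.prems(4))
  then show ?case
    using tri_below[OF Suc.prems(1)] Suc.prems(4)[of "(Suc x1, x2, x3)"]
    by (simp add: path_sum_Suc[OF Suc.prems(1)])
qed

section \<open>Moving a point of an independent set downwards\<close>

definition subtri :: "nat \<Rightarrow> nat \<Rightarrow> nat \<Rightarrow> nat \<Rightarrow> dot set" where
  "subtri n a1 a2 a3 = {(x1, x2, x3) \<in> tri n. a1 \<le> x1 \<and> a2 \<le> x2 \<and> a3 \<le> x3}"

lemma mem_subtri [simp]: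
  "(x1, x2, x3) \<in> subtri n a1 a2 a3 \<longleftrightarrow>
     (x1, x2, x3) \<in> tri n \<and> a1 \<le> x1 \<and> a2 \<le> x2 \<and> a3 \<le> x3"
  by (simp add: subtri_def)

lemma subtri_eq_empty:
  assumes "n \<ge> 1" "n \<le> a1 + a2 + a3"
  shows "subtri n a1 a2 a3 = {}"
  using assms by (auto simp: subtri_def tri_def)

text \<open>This form avoids subtraction and also admits the empty subtriangles with
  \<open>a1 + a2 + a3 = n\<close>, which can arise as intersections of two subtriangles.\<close>

lemma tri_indep_alt:
  assumes "n \<ge> 1"
  shows "tri_indep n I \<longleftrightarrow> I \<subseteq> tri n \<and>
    (\<forall>a1 a2 a3. a1 + a2 + a3 \<le> n \<longrightarrow> card (I \<inter> subtri n a1 a2 a3) + (a1 + a2 + a3) \<le> n)"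
    (is "_ \<longleftrightarrow> _ \<and> ?R")
proof -
  have "(\<forall>k a1 a2 a3. 1 \<le> k \<and> k \<le> n \<and> a1 + a2 + a3 = n - k \<longrightarrow>
      card (I \<inter> subtri n a1 a2 a3) \<le> k) \<longleftrightarrow> ?R" (is "?L \<longleftrightarrow> _")
  proof
    assume L: ?L
    show ?R
    proof (intro allI impI)
      fix a1 a2 a3 assume "a1 + a2 + a3 \<le> n"
      then consider "a1 + a2 + a3 = n" | "a1 + a2 + a3 < n" by linarith
      then show "card (I \<inter> subtri n a1 a2 a3) + (a1 + a2 + a3) \<le> n"
      proof cases
        case 1
        then show ?thesis using assms by (simp add: subtri_eq_empty)
      next
        case 2
        then have "card (I \<inter> subtri n a1 a2 a3) \<le> n - (a1 + a2 + a3)"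
          by (intro L[rule_format]) auto
        then show ?thesis using 2 by linarith
      qed
    qed
  next
    assume R: ?R
    show ?L
    proof (intro allI impI)
      fix k a1 a2 a3 assume k: "1 \<le> k \<and> k \<le> n \<and> a1 + a2 + a3 = n - k"
      then have "card (I \<inter> subtri n a1 a2 a3) + (a1 + a2 + a3) \<le> n"
        by (intro R[rule_format]) linarith
      then show "card (I \<inter> subtri n a1 a2 a3) \<le> k" using k by linarith
    qed
  qed
  then show ?thesis
    by (simp add: tri_indep_def subtri_def)
qed

text \<open>Two subtriangles meet in the one given by the maxima of their bounds, and their union
  lies in the one given by the minima.\<close>

lemma card_subtri_submodular:
  assumes "finite J"
  shows "card (J \<inter> subtri n a1 a2 a3) + card (J \<inter> subtri n b1 b2 b3) \<le>
    card (J \<inter> subtri n (min a1 b1) (min a2 b2) (min a3 b3)) +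
    card (J \<inter> subtri n (max a1 b1) (max a2 b2) (max a3 b3))"
proof -
  let ?A = "J \<inter> subtri n a1 a2 a3" and ?B = "J \<inter> subtri n b1 b2 b3"
  have "card ?A + card ?B = card (?A \<union> ?B) + card (?A \<inter> ?B)"
    using assms by (intro card_Un_Int) auto
  moreover have "card (?A \<union> ?B) \<le> card (J \<inter> subtri n (min a1 b1) (min a2 b2) (min a3 b3))"
    using assms by (intro card_mono) auto
  moreover have "card (?A \<inter> ?B) \<le> card (J \<inter> subtri n (max a1 b1) (max a2 b2) (max a3 b3))"
    using assms by (intro card_mono) auto
  ultimately show ?thesis by linarith
qed

text \<open>If \<open>y\<close> is in \<open>J\<close>, the subtriangle of side 1 at
  \<open>y\<close> is tight. Otherwise a bound violated by adding \<open>y\<close> belongs to a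
  subtriangle that contains \<open>y\<close> and is already full.\<close>

lemma tight_subtri:
  assumes "n \<ge> 1" "tri_indep n J" "y \<in> tri n" "y \<in> J \<or> \<not> tri_indep n (insert y J)"
  obtains a1 a2 a3 where "a1 + a2 + a3 \<le> n" "y \<in> subtri n a1 a2 a3"
    "card (J \<inter> subtri n a1 a2 a3) + (a1 + a2 + a3) = n"
proof (cases "y \<in> J")
  case True
  obtain y1 y2 y3 where y: "y = (y1, y2, y3)" by (cases y)
  have "J \<inter> subtri n y1 y2 y3 = {y}"
    using True y assms(3) by (auto simp: subtri_def tri_def)
  then show ?thesis
    using that[of y1 y2 y3] assms(1,3) y by (auto simp: tri_def)
next
  case False
  have J: "J \<subseteq> tri n"
    "\<And>a1 a2 a3. a1 + a2 + a3 \<le> n \<Longrightarrow> card (J \<inter> subtri n a1 a2 a3) + (a1 + a2 + a3) \<le> n"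
    using assms(1,2) by (auto simp: tri_indep_alt)
  from False assms obtain a1 a2 a3 where a: "a1 + a2 + a3 \<le> n"
    "card (insert y J \<inter> subtri n a1 a2 a3) + (a1 + a2 + a3) > n"
    by (auto simp: tri_indep_alt not_le)
  then have y: "y \<in> subtri n a1 a2 a3"
    using J(2)[OF a(1)] by (cases "y \<in> subtri n a1 a2 a3") auto
  have "finite (J \<inter> subtri n a1 a2 a3)"
    using J(1) finite_tri by (meson finite_Int finite_subset)
  then have "card (insert y J \<inter> subtri n a1 a2 a3) = Suc (card (J \<inter> subtri n a1 a2 a3))"
    using y False by simp
  then show ?thesis
    using that[OF a(1) y] a(2) J(2)[OF a(1)] by simp
qed

text \<open>
  If neither replacement worked, the two points below \<open>x\<close> would lie in subtriangles that are
  tight for \<open>I - {x}\<close> and avoid \<open>x\<close>. By submodularity the smallest subtriangle containing both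
  of these would be tight as well, but it contains \<open>x\<close>.
\<close>

lemma tri_indep_move_down:
  assumes "n \<ge> 1" "tri_indep n I" and x: "(Suc x1, x2, x3) \<in> I" (is "?x \<in> I")
  obtains y where "y = (x1, Suc x2, x3) \<or> y = (x1, x2, Suc x3)"
    "y \<notin> I" "tri_indep n (insert y (I - {?x}))"
proof -
  define J where "J = I - {?x}"
  have I: "I \<subseteq> tri n"
    "\<And>a1 a2 a3. a1 + a2 + a3 \<le> n \<Longrightarrow> card (I \<inter> subtri n a1 a2 a3) + (a1 + a2 + a3) \<le> n"
    using assms(1,2) by (auto simp: tri_indep_alt)
  have finI: "finite I" using I(1) finite_tri by (rule finite_subset)
  then have finJ: "finite J" by (simp add: J_def)
  have card_le: "card (J \<inter> T) \<le> card (I \<inter> T)" for T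
    using finI by (intro card_mono) (auto simp: J_def)
  have card_x: "card (I \<inter> T) = Suc (card (J \<inter> T))" if "?x \<in> T" for T
  proof -
    have "I \<inter> T = insert ?x (J \<inter> T)" using x that by (auto simp: J_def)
    then show ?thesis using finJ by (simp add: J_def)
  qed
  have J: "tri_indep n J"
    unfolding tri_indep_alt[OF assms(1)]
  proof (intro conjI allI impI)
    show "J \<subseteq> tri n" using I(1) by (auto simp: J_def)
    show "card (J \<inter> subtri n a1 a2 a3) + (a1 + a2 + a3) \<le> n" if "a1 + a2 + a3 \<le> n" for a1 a2 a3
      using I(2)[OF that] card_le[of "subtri n a1 a2 a3"] by linarith
  qed
  have xtri: "?x \<in> tri n" using x I(1) by blast
  \<comment> \<open>Putting \<open>?x\<close> back into a full subtriangle would violate the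
    independence of \<open>I\<close>.\<close>
  have avoid: "?x \<notin> subtri n a1 a2 a3"
    if "a1 + a2 + a3 \<le> n" "card (J \<inter> subtri n a1 a2 a3) + (a1 + a2 + a3) \<ge> n" for a1 a2 a3
    using I(2)[OF that(1)] card_x[of "subtri n a1 a2 a3"] that(2) by linarith
  let ?l = "(x1, Suc x2, x3)" and ?r = "(x1, x2, Suc x3)"
  have lr: "?l \<in> tri n" "?r \<in> tri n" using tri_below[OF xtri] by auto
  have "\<exists>y \<in> {?l, ?r}. \<not> (y \<in> J \<or> \<not> tri_indep n (insert y J))"
  proof (rule ccontr)
    assume "\<not> ?thesis"
    then have l: "?l \<in> J \<or> \<not> tri_indep n (insert ?l J)"
      and r: "?r \<in> J \<or> \<not> tri_indep n (insert ?r J)" by auto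
    obtain a1 a2 a3 where a: "a1 + a2 + a3 \<le> n" "?l \<in> subtri n a1 a2 a3"
      "card (J \<inter> subtri n a1 a2 a3) + (a1 + a2 + a3) = n"
      using tight_subtri[OF assms(1) J lr(1) l] by blast
    obtain b1 b2 b3 where b: "b1 + b2 + b3 \<le> n" "?r \<in> subtri n b1 b2 b3"
      "card (J \<inter> subtri n b1 b2 b3) + (b1 + b2 + b3) = n"
      using tight_subtri[OF assms(1) J lr(2) r] by blast
    \<comment> \<open>Only the second coordinate drops from \<open>?l\<close> to \<open>?x\<close>,
      so a subtriangle separating them has exactly \<open>Suc x2\<close> as its second
      bound.\<close>
    have "a2 = Suc x2" "a1 \<le> x1" "a3 \<le> x3"
      using avoid[of a1 a2 a3] a xtri by auto
    moreover have "b3 = Suc x3" "b1 \<le> x1" "b2 \<le> x2"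
      using avoid[of b1 b2 b3] b xtri by auto
    moreover have "Suc x1 + x2 + x3 = n - 1" using xtri by (simp add: tri_def)
    ultimately have
      \<comment> \<open>The sum is at most \<open>x1 + Suc x2 + Suc x3 = n\<close>, with equality
        possible.\<close>
      max_le: "max a1 b1 + max a2 b2 + max a3 b3 \<le> n"
      and x_in: "?x \<in> subtri n (min a1 b1) (min a2 b2) (min a3 b3)"
      using xtri by (auto simp: min_def max_def)
    have min_le: "min a1 b1 + min a2 b2 + min a3 b3 \<le> n"
      using a(1) by linarith
    have "card (J \<inter> subtri n (max a1 b1) (max a2 b2) (max a3 b3)) +
        (max a1 b1 + max a2 b2 + max a3 b3) \<le> n"
      using J max_le assms(1) by (simp add: tri_indep_alt)
    moreover have "(max a1 b1 + max a2 b2 + max a3 b3) + (min a1 b1 + min a2 b2 + min a3 b3) =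
        (a1 + a2 + a3) + (b1 + b2 + b3)"
      by (simp add: min_def max_def)
    ultimately have "card (J \<inter> subtri n (min a1 b1) (min a2 b2) (min a3 b3)) +
        (min a1 b1 + min a2 b2 + min a3 b3) \<ge> n"
      using card_subtri_submodular[OF finJ, of n a1 a2 a3 b1 b2 b3] a(3) b(3) by linarith
    then show False
      using avoid[OF min_le] x_in by blast
  qed
  then obtain y where "y \<in> {?l, ?r}" "y \<notin> J" "tri_indep n (insert y J)"
    by blast
  then show ?thesis
    using that[of y] by (auto simp: J_def)
qed

section \<open>Weights that separate an independent set\<close>

text \<open>Induction on the total height of the set. The disjoint paths are not kept as objects:
  only the labels \<open>\<pi>\<close> of their endpoints and the resulting unit vectors are
  recorded.\<close>

lemma ex_separating_weights:
  assumes "n \<ge> 1" "tri_indep n I"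
  shows "\<exists>w \<pi>. inj_on \<pi> I \<and> \<pi> ` I \<subseteq> {1..n} \<and>
    (\<forall>D\<in>I. \<forall>i\<in>{1..n}. path_sum n w D i = (if i = \<pi> D then 1 else 0))"
  using assms(2)
proof (induction "\<Sum>D\<in>I. fst D" arbitrary: I rule: less_induct)
  case less
  have I: "I \<subseteq> tri n" using less.prems by (simp add: tri_indep_def)
  then have finI: "finite I" using finite_tri finite_subset by blast
  show ?case
  proof (cases "\<forall>D\<in>I. fst D = 0")
    case True
    then have D: "\<exists>x2 x3. D = (0, x2, x3) \<and> x2 + x3 = n - 1" if "D \<in> I" for D
    proof -
      have "D \<in> tri n" "fst D = 0" using that I True by auto
      then show ?thesis by (cases D) (auto simp: tri_def)
    qed
    have "inj_on (\<lambda>D. Suc (snd (snd D))) I"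
    proof (rule inj_onI)
      fix D D' assume "D \<in> I" "D' \<in> I" "Suc (snd (snd D)) = Suc (snd (snd D'))"
      then show "D = D'" using D[of D] D[of D'] by auto
    qed
    moreover have "Suc (snd (snd D)) \<in> {1..n}" if "D \<in> I" for D
      using D[OF that] assms(1) by auto
    moreover have "path_sum n w D i = (if i = Suc (snd (snd D)) then 1 else 0)"
      if "D \<in> I" "i \<in> {1..n}" for w D i
      using D[OF that(1)] that I path_sum_bottom[of "fst (snd D)" "snd (snd D)" n i w] by auto
    ultimately show ?thesis
      \<comment> \<open>On the bottom row path sums do not depend on the weights, so any
        \<open>w\<close> will do.\<close>
      by (intro exI[of _ "\<lambda>D. Suc (snd (snd D))"] exI[of _ undefined] conjI ballI image_subsetI)
  next
    case False
    then have "I \<noteq> {}" by auto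
    \<comment> \<open>Since \<open>x\<close> is highest, no path from another dot of
      \<open>I\<close> or from \<open>y\<close> can pass through it.\<close>
    obtain x where x: "x \<in> I" "\<And>D. D \<in> I \<Longrightarrow> fst D \<le> fst x"
    proof -
      have "Max (fst ` I) \<in> fst ` I" using finI \<open>I \<noteq> {}\<close> by simp
      then obtain x where "x \<in> I" "fst x = Max (fst ` I)" by auto
      then show ?thesis using that[of x] finI by simp
    qed
    then have "fst x \<noteq> 0" using False by fastforce
    then obtain x1 x2 x3 where x_eq: "x = (Suc x1, x2, x3)"
      by (cases x) (auto simp: gr0_conv_Suc)
    obtain y where y: "y = (x1, Suc x2, x3) \<or> y = (x1, x2, Suc x3)" "y \<notin> I"
      "tri_indep n (insert y (I - {x}))"
      using tri_indep_move_down[OF assms(1) less.prems] x(1) x_eq by blast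
    define J where "J = insert y (I - {x})"
    have J: "J \<subseteq> tri n" using y(3) by (simp add: J_def tri_indep_def)
    have "fst y < fst x" using y(1) x_eq by auto
    then have "(\<Sum>D\<in>J. fst D) < (\<Sum>D\<in>I. fst D)"
      using finI x(1) y(2) by (simp add: J_def sum.remove)
    from less.hyps[OF this] obtain w \<pi> where w: "inj_on \<pi> J" "\<pi> ` J \<subseteq> {1..n}"
      "\<And>D i. D \<in> J \<Longrightarrow> i \<in> {1..n} \<Longrightarrow> path_sum n w D i = (if i = \<pi> D then 1 else 0)"
      using y(3) unfolding J_def by blast
    \<comment> \<open>Under \<open>w'\<close> the dot \<open>x\<close> has the same path sums as
      \<open>y\<close>, and so inherits its label.\<close>
    define w' where "w' = (\<lambda>(u, v). if u = x then if v = y then 1 else 0 else w (u, v))"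
    have same: "path_sum n w' D i = path_sum n w D i"
      if "D \<in> tri n" "fst D \<le> fst x" "D \<noteq> x" "i \<in> {1..n}" for D i
    proof -
      obtain y1 y2 y3 where D: "D = (y1, y2, y3)" by (cases D)
      have "w' (u, v) = w (u, v)" if "u = D \<or> fst u < y1" for u v
        using that D \<open>fst D \<le> fst x\<close> \<open>D \<noteq> x\<close> by (auto simp: w'_def)
      then show ?thesis
        unfolding D using that D by (intro path_sum_cong_below) auto
    qed
    have "path_sum n w' x i = path_sum n w' y i" for i
    proof -
      have "(Suc x1, x2, x3) \<in> tri n" using I x(1) x_eq by blast
      from path_sum_Suc[OF this, of w' i] show ?thesis
        using y(1) by (elim disjE) (simp_all add: x_eq w'_def)
    qed
    moreover have "path_sum n w' D i = (if i = \<pi> D then 1 else 0)"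
      if "D \<in> J" "i \<in> {1..n}" for D i
    proof -
      have "fst D \<le> fst x" "D \<noteq> x"
        using that(1) x(2)[of D] \<open>fst y < fst x\<close> by (auto simp: J_def)
      then have "path_sum n w' D i = path_sum n w D i"
        using same that J by blast
      then show ?thesis using w(3)[OF that] by simp
    qed
    ultimately have "\<forall>D\<in>I. \<forall>i\<in>{1..n}.
        path_sum n w' D i = (if i = (\<pi>(x := \<pi> y)) D then 1 else 0)"
      by (simp add: J_def)
    moreover have "inj_on (\<pi>(x := \<pi> y)) I"
      using w(1) y(2) by (auto simp: J_def inj_on_def)
    moreover have "(\<pi>(x := \<pi> y)) ` I \<subseteq> {1..n}"
      using w(2) by (auto simp: J_def)
    ultimately show ?thesis
      by (intro exI[of _ w'] exI[of _ "\<pi>(x := \<pi> y)"] conjI)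
  qed
qed

section \<open>Linear algebra\<close>

text \<open>Injectivity follows from the same hypothesis: a repeated vector gives a relation with
  coefficients 1 and -1.\<close>

lemma lin_indep_familyI:
  assumes "finite I" and dim: "\<And>x. x \<in> I \<Longrightarrow> dim_vec (v x) = n"
    and zero: "\<And>c x. (\<And>j. j < n \<Longrightarrow> (\<Sum>x\<in>I. c x * v x $ j) = 0) \<Longrightarrow> x \<in> I \<Longrightarrow> c x = 0"
  shows "lin_indep_family n v I"
proof -
  interpret vec_space "TYPE(complex)" n .
  have inj: "inj_on v I"
  proof (rule inj_onI, rule ccontr)
    fix x y assume xy: "x \<in> I" "y \<in> I" "v x = v y" "x \<noteq> y"
    define c :: "'a \<Rightarrow> complex" where "c = (\<lambda>z. if z = x then 1 else if z = y then -1 else 0)"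
    have "(\<Sum>z\<in>I. c z * v z $ j) = 0" for j
    proof -
      have "(\<Sum>z\<in>I. c z * v z $ j) = (\<Sum>z\<in>{x, y}. c z * v z $ j)"
        using assms(1) xy by (intro sum.mono_neutral_right) (auto simp: c_def)
      also have "\<dots> = 0" using xy by (simp add: c_def)
      finally show ?thesis .
    qed
    from zero[OF this xy(1)] show False by (simp add: c_def)
  qed
  have "lin_indpt (v ` I)"
  proof
    assume "lin_dep (v ` I)"
    then obtain A a u where A: "finite A" "A \<subseteq> v ` I" "lincomb a A = 0\<^sub>v n" "u \<in> A" "a u \<noteq> 0"
      unfolding lin_dep_def by (auto simp: module_vec_simps)
    have A_carrier: "A \<subseteq> carrier_vec n"
      using A(2) dim by (blast intro: carrier_vecI)
    \<comment> \<open>The relation among vectors in \<open>A\<close> is pulled back to the index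
      set, with 0 outside \<open>A\<close>.\<close>
    define c where "c = (\<lambda>x. if v x \<in> A then a (v x) else 0)"
    have "(\<Sum>x\<in>I. c x * v x $ j) = 0" if "j < n" for j
    proof -
      have "(\<Sum>x\<in>I. c x * v x $ j) = (\<Sum>z\<in>v ` I. (if z \<in> A then a z else 0) * z $ j)"
        by (simp add: sum.reindex[OF inj] c_def)
      also have "\<dots> = (\<Sum>z\<in>A. a z * z $ j)"
        using A(2) assms(1) by (intro sum.mono_neutral_cong_right) auto
      also have "\<dots> = lincomb a A $ j"
        by (simp add: lincomb_index[OF that A_carrier])
      finally show ?thesis using A(3) that by simp
    qed
    moreover obtain x where "x \<in> I" "v x = u" using A by blast
    ultimately have "c x = 0" using zero by blast
    with A \<open>v x = u\<close> show False by (simp add: c_def)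
  qed
  with inj show ?thesis by (simp add: lin_indep_family_def)
qed

text \<open>Steinitz exchange: the cardinality of the completing set \<open>C\<close> is
  nonnegative, which gives the bound.\<close>

lemma card_le_of_lin_indep_family:
  assumes "lin_indep_family n v I" "finite S" "finite B" "B \<subseteq> carrier_vec n" "S \<subseteq> I"
    and "v ` S \<subseteq> LinearCombinations.module.span class_ring (module_vec TYPE(complex) n) B"
  shows "card S \<le> card B"
proof -
  interpret vec_space "TYPE(complex)" n .
  have "lin_indpt (v ` S)"
    using assms(1,5) subset_li_is_li unfolding lin_indep_family_def by (meson image_mono)
  then obtain C :: "complex vec set" where "int (card C) \<le> int (card B) - int (card (v ` S))"
    using replacement[of "v ` S" B] assms by (auto simp: cV)
  moreover have "card (v ` S) = card S"
    using assms(1,5) by (meson card_image inj_on_subset lin_indep_family_def)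
  ultimately show ?thesis by linarith
qed

section \<open>Linear independence implies independence in the matroid\<close>

lemma path_vector_in_span:
  assumes "(x1, x2, x3) \<in> subtri n a1 a2 a3"
  shows "path_vector n w (x1, x2, x3) \<in>
    LinearCombinations.module.span class_ring (module_vec TYPE(complex) n)
      (path_vector n w ` {x \<in> subtri n a1 a2 a3. fst x = a1})"
    (is "_ \<in> LinearCombinations.module.span _ _ ?B")
proof -
  interpret vec_space "TYPE(complex)" n .
  have B: "?B \<subseteq> carrier_vec n" by (auto simp: path_vector_def)
  interpret sub: submodule class_ring "span ?B" V
    using span_is_submodule B by simp
  show ?thesis using assms
  proof (induction x1 arbitrary: x2 x3)
    case 0
    then have "path_vector n w (0, x2, x3) \<in> ?B" by auto
    then show ?case using in_own_span B by auto
  next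
    case (Suc x1)
    show ?case
    proof (cases "a1 = Suc x1")
      case True
      then have "path_vector n w (Suc x1, x2, x3) \<in> ?B" using Suc.prems by auto
      then show ?thesis using in_own_span B by auto
    next
      \<comment> \<open>Here \<open>a1 \<le> x1\<close>, so both dots below stay in the subtriangle
        and the recursion for path sums applies.\<close>
      case False
      have tri: "(Suc x1, x2, x3) \<in> tri n" using Suc.prems by simp
      have "path_vector n w (Suc x1, x2, x3) =
          w ((Suc x1, x2, x3), (x1, Suc x2, x3)) \<cdot>\<^sub>v path_vector n w (x1, Suc x2, x3) +
          w ((Suc x1, x2, x3), (x1, x2, Suc x3)) \<cdot>\<^sub>v path_vector n w (x1, x2, Suc x3)"
        by (intro eq_vecI) (auto simp: path_vector_def path_sum_Suc[OF tri])
      moreover have "path_vector n w (x1, Suc x2, x3) \<in> span ?B"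
        "path_vector n w (x1, x2, Suc x3) \<in> span ?B"
        using False Suc.prems tri_below[OF tri] by (auto intro!: Suc.IH)
      ultimately show ?thesis
        using sub.smult_closed sub.m_closed by simp
    qed
  qed
qed

text \<open>A dot of this row is determined by its third coordinate, which ranges over an
  interval.\<close>

lemma card_subtri_bottom:
  assumes "n \<ge> 1"
  shows "finite {x \<in> subtri n a1 a2 a3. fst x = a1}"
    "card {x \<in> subtri n a1 a2 a3. fst x = a1} \<le> n - (a1 + a2 + a3)"
proof -
  have sub: "{x \<in> subtri n a1 a2 a3. fst x = a1} \<subseteq>
      (\<lambda>x3. (a1, n - 1 - a1 - x3, x3)) ` {a3..<n - (a1 + a2)}"
    using assms by (auto simp: subtri_def tri_def image_iff)
  then show "finite {x \<in> subtri n a1 a2 a3. fst x = a1}"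
    by (rule finite_subset) simp
  have "card {x \<in> subtri n a1 a2 a3. fst x = a1} \<le> card {a3..<n - (a1 + a2)}"
    using sub by (rule surj_card_le[rotated]) simp
  then show "card {x \<in> subtri n a1 a2 a3. fst x = a1} \<le> n - (a1 + a2 + a3)"
    by simp
qed

text \<open>The dots of \<open>I\<close> in a subtriangle have independent vectors in the span of
  its bottom row, which bounds their number.\<close>

lemma lin_indep_imp_tri_indep:
  assumes "n \<ge> 1" "I \<subseteq> tri n" "lin_indep_family n (path_vector n w) I"
  shows "tri_indep n I"
  unfolding tri_indep_alt[OF assms(1)]
proof (intro conjI allI impI)
  fix a1 a2 a3 assume a: "a1 + a2 + a3 \<le> n"
  let ?B = "{x \<in> subtri n a1 a2 a3. fst x = a1}"
  have "finite (I \<inter> subtri n a1 a2 a3)"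
    using assms(2) finite_tri by (meson finite_Int finite_subset)
  then have "card (I \<inter> subtri n a1 a2 a3) \<le> card (path_vector n w ` ?B)"
    using card_subtri_bottom(1)[OF assms(1)] path_vector_in_span[of _ _ _ n a1 a2 a3 w]
    by (intro card_le_of_lin_indep_family[OF assms(3)]) (auto simp: path_vector_def)
  also have "\<dots> \<le> card ?B"
    using card_subtri_bottom(1)[OF assms(1)] by (rule card_image_le)
  finally show "card (I \<inter> subtri n a1 a2 a3) + (a1 + a2 + a3) \<le> n"
    using card_subtri_bottom(2)[OF assms(1), of a1 a2 a3] a by linarith
qed (use assms in auto)

section \<open>Independence in the matroid implies linear independence\<close>

lemma tri_indep_imp_lin_indep:
  assumes "n \<ge> 1" "alg_independent_on (tri_edges n) w" "tri_indep n I"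
  shows "lin_indep_family n (path_vector n w) I"
proof -
  have I: "I \<subseteq> tri n" using assms(3) by (simp add: tri_indep_def)
  then have finI: "finite I" using finite_tri finite_subset by blast
  then obtain xs where xs: "set xs = I" "distinct xs"
    using finite_distinct_list by blast
  define m where "m = length xs"
  have xs_in: "xs ! i \<in> I" if "i < m" for i
    using that xs by (auto simp: m_def)
  obtain w0 \<pi> where w0: "inj_on \<pi> I" "\<pi> ` I \<subseteq> {1..n}"
    "\<And>D i. D \<in> I \<Longrightarrow> i \<in> {1..n} \<Longrightarrow> path_sum n w0 D i = (if i = \<pi> D then 1 else 0)"
    using ex_separating_weights[OF assms(1,3)] by metis
  \<comment> \<open>Columns are the dots of \<open>I\<close>, rows the bottom labels they are routed
    to at \<open>w0\<close>; this minor is the identity at \<open>w0\<close>.\<close>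
  define M where "M = (\<lambda>w. mat m m (\<lambda>(i, j). path_sum n w (xs ! j) (\<pi> (xs ! i))))"
  have \<pi>: "1 \<le> \<pi> D" "\<pi> D \<le> n" if "D \<in> I" for D using w0(2) that by auto
  have "M w0 = 1\<^sub>m m"
  proof (rule eq_matI)
    fix i j assume "i < dim_row (1\<^sub>m m)" "j < dim_col (1\<^sub>m m)"
    then have ij: "i < m" "j < m" by auto
    have "\<pi> (xs ! i) = \<pi> (xs ! j) \<longleftrightarrow> i = j"
      using w0(1) xs_in[OF ij(1)] xs_in[OF ij(2)] xs(2) ij
      by (auto simp: m_def nth_eq_iff_index_eq dest: inj_onD)
    then show "M w0 $$ (i, j) = 1\<^sub>m m $$ (i, j)"
      using ij w0(3)[OF xs_in[OF ij(2)], of "\<pi> (xs ! i)"] \<pi>[OF xs_in[OF ij(1)]]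
      by (simp add: M_def)
  qed (auto simp: M_def)
  then have "det (M w0) \<noteq> 0" by simp
  moreover have "poly_fun (tri_edges n) (\<lambda>w. det (M w))"
    unfolding M_def
  proof (rule poly_fun_det)
    fix i j assume "i < m" "j < m"
    then show "poly_fun (tri_edges n) (\<lambda>w. path_sum n w (xs ! j) (\<pi> (xs ! i)))"
      using xs_in I \<pi> poly_fun_path_sum by (metis prod_cases3 subsetD)
  qed
  ultimately have det: "det (M w) \<noteq> 0"
    using alg_independent_poly_fun_nonzero[OF assms(2)] by blast
  show ?thesis
  proof (rule lin_indep_familyI[OF finI])
    fix c D
    assume c: "\<And>j. j < n \<Longrightarrow> (\<Sum>x\<in>I. c x * path_vector n w x $ j) = 0" and D: "D \<in> I"
    \<comment> \<open>A linear relation, read at the coordinates chosen by \<open>\<pi>\<close>,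
      puts its coefficient vector in the kernel of \<open>M w\<close>.\<close>
    define u where "u = vec m (\<lambda>j. c (xs ! j))"
    have "M w *\<^sub>v u = 0\<^sub>v m"
    proof (rule eq_vecI)
      fix i assume "i < dim_vec (0\<^sub>v m)"
      then have i: "i < m" by simp
      have "(M w *\<^sub>v u) $ i = (\<Sum>j = 0..<m. path_sum n w (xs ! j) (\<pi> (xs ! i)) * c (xs ! j))"
        using i by (simp add: M_def u_def scalar_prod_def)
      also have "\<dots> = (\<Sum>x\<in>I. path_sum n w x (\<pi> (xs ! i)) * c x)"
        using xs by (intro sum.reindex_bij_betw)
          (auto simp: m_def bij_betw_def inj_on_nth set_conv_nth lessThan_atLeast0[symmetric])
      \<comment> \<open>Labels start at 1 and vector indices at 0, hence the shift.\<close>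
      also have "\<dots> = (\<Sum>x\<in>I. c x * path_vector n w x $ (\<pi> (xs ! i) - 1))"
        using \<pi>[OF xs_in[OF i]] by (intro sum.cong) (auto simp: path_vector_def)
      also have "\<dots> = 0"
        using \<pi>[OF xs_in[OF i]] by (intro c) auto
      finally show "(M w *\<^sub>v u) $ i = 0\<^sub>v m $ i" using i by simp
    qed (simp add: M_def)
    moreover have "M w \<in> carrier_mat m m" "u \<in> carrier_vec m"
      by (auto simp: M_def u_def)
    ultimately have "u = 0\<^sub>v m"
      using det det_0_iff_vec_prod_zero by blast
    moreover obtain j where "j < m" "D = xs ! j"
      using D xs by (metis in_set_conv_nth m_def)
    ultimately show "c D = 0"
      by (metis index_vec index_zero_vec(1) u_def)
  qed (simp add: path_vector_def)
qed

theorem theorem6p4: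
  fixes n :: nat and w :: "dot \<times> dot \<Rightarrow> complex"
  assumes "n \<ge> 1"
    and "alg_independent_on (tri_edges n) w"
  shows "\<forall>I. I \<subseteq> tri n \<longrightarrow>
           (tri_indep n I \<longleftrightarrow> lin_indep_family n (path_vector n w) I)"
  using tri_indep_imp_lin_indep[OF assms] lin_indep_imp_tri_indep[OF assms(1)] by blast

end
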